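(* Let $P$ be an $N$-free poset with no infinite antichains. Then there exist a chain $C$ of $P$ and a partition of $P$ into antichains such that every part of the partition intersects $C$.
   Context: Posets are not necessarily finite. A chain is a totally ordered subset; an antichain is a set of pairwise incomparable elements. A $4$-tuple $(a,b,c,d)$ of distinct elements of a poset $P$ is an $N$ in $P$ if $a<b$, $c<b$, $c<d$, and these are the only strict comparabilities among $a,b,c,d$. $P$ is $N$-free if it does not contain an $N$. *)

theory Defs
  imports Main "HOL-Library.Disjoint_Sets"
begin

text \<open>A poset is a carrier set \<open>P\<close> with a (reflexive) order relation \<open>r\<close> such that
  \<open>partial_order_on P r\<close>. Chains are the library's \<open>Chains r\<close>.\<close>

definition incomparable :: "'a rel \<Rightarrow> 'a \<Rightarrow> 'a \<Rightarrow> bool" where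
  "incomparable r x y \<longleftrightarrow> (x, y) \<notin> r \<and> (y, x) \<notin> r"

definition antichain_on :: "'a set \<Rightarrow> 'a rel \<Rightarrow> 'a set \<Rightarrow> bool" where
  "antichain_on P r A \<longleftrightarrow> A \<subseteq> P \<and> (\<forall>x\<in>A. \<forall>y\<in>A. x \<noteq> y \<longrightarrow> incomparable r x y)"

text \<open>For distinct elements, \<open>(x, y) \<in> r\<close> expresses the strict relation \<open>x < y\<close>.\<close>

definition is_N :: "'a set \<Rightarrow> 'a rel \<Rightarrow> 'a \<Rightarrow> 'a \<Rightarrow> 'a \<Rightarrow> 'a \<Rightarrow> bool" where
  "is_N P r a b c d \<longleftrightarrow>
     {a, b, c, d} \<subseteq> P \<and> distinct [a, b, c, d] \<and>
     (a, b) \<in> r \<and> (c, b) \<in> r \<and> (c, d) \<in> r \<and>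
     incomparable r a c \<and> incomparable r a d \<and> incomparable r b d"

definition N_free :: "'a set \<Rightarrow> 'a rel \<Rightarrow> bool" where
  "N_free P r \<longleftrightarrow> \<not> (\<exists>a b c d. is_N P r a b c d)"

end

theory Submission
  imports Defs
begin

unbundle cardinal_syntax

text \<open>
  Only the comparability graph matters: it contains no induced path on four vertices and no
  infinite independent set, and we look for a clique together with a proper colouring by the
  vertices of that clique. A set \<open>X\<close> of at least two vertices is a disjoint union or a join
  of two nonempty parts. Hence every component \<open>K\<close> of the incomparability graph of \<open>X\<close> is a
  single vertex or a disjoint union \<open>U \<union> V\<close>. Given solutions for \<open>U\<close> and \<open>V\<close>, embed
  the smaller clique (by cardinality) into the larger one and identify colours accordingly; the
  solutions for the various \<open>K\<close> are simply joined. This recursion terminates, since a vertex of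
  \<open>V\<close> is nonadjacent to everything in \<open>U\<close>, so that an infinite branch would produce an infinite
  independent set.
\<close>

section \<open>Colouring a graph by the vertices of a clique\<close>

text \<open>One notion serves both decompositions: \<open>R\<close> is nonadjacency for a disjoint
  union and \<open>E\<close> for a join.\<close>

definition splits :: "('a \<Rightarrow> 'a \<Rightarrow> bool) \<Rightarrow> 'a set \<Rightarrow> bool" where
  "splits R X \<longleftrightarrow> (\<exists>U\<subseteq>X. U \<noteq> {} \<and> U \<noteq> X \<and> (\<forall>u\<in>U. \<forall>v\<in>X - U. R u v))"

text \<open>The colours are the clique vertices, so \<open>f\<close> retracts \<open>X\<close> onto
  \<open>C\<close>, and its fibres are independent sets meeting \<open>C\<close>. The clique may be
  infinite.\<close>

definition clique_colouring ::
    "('a \<Rightarrow> 'a \<Rightarrow> bool) \<Rightarrow> 'a set \<Rightarrow> 'a set \<Rightarrow> ('a \<Rightarrow> 'a) \<Rightarrow> bool" where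
  "clique_colouring E X C f \<longleftrightarrow> (C \<subseteq> X \<and> (\<forall>x\<in>C. \<forall>y\<in>C. x \<noteq> y \<longrightarrow> E x y) \<and>
     f ` X \<subseteq> C \<and> (\<forall>c\<in>C. f c = c) \<and> (\<forall>x\<in>X. \<forall>y\<in>X. f x = f y \<longrightarrow> \<not> E x y))"

definition clique_colourable :: "('a \<Rightarrow> 'a \<Rightarrow> bool) \<Rightarrow> 'a set \<Rightarrow> bool" where
  "clique_colourable E X \<longleftrightarrow> (\<exists>C f. clique_colouring E X C f)"

lemma clique_colourable_disjoint_union:
  assumes sym: "\<And>x y. E x y \<Longrightarrow> E y x"
    and U: "clique_colourable E U" and V: "clique_colourable E V"
    and UV: "U \<inter> V = {}" "\<And>u v. u \<in> U \<Longrightarrow> v \<in> V \<Longrightarrow> \<not> E u v"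
  shows "clique_colourable E (U \<union> V)"
proof -
  \<comment> \<open>Here \<open>A\<close> is the side with the larger clique, which is kept;
    \<open>g\<close> renames the colours of \<open>B\<close> injectively into it.\<close>
  have *: "clique_colourable E (A \<union> B)"
    if A: "C \<subseteq> A" "\<forall>x\<in>C. \<forall>y\<in>C. x \<noteq> y \<longrightarrow> E x y" "f ` A \<subseteq> C" "\<forall>c\<in>C. f c = c"
        "\<forall>x\<in>A. \<forall>y\<in>A. f x = f y \<longrightarrow> \<not> E x y"
      and B: "f' ` B \<subseteq> C'" "\<forall>x\<in>B. \<forall>y\<in>B. f' x = f' y \<longrightarrow> \<not> E x y"
      and AB: "A \<inter> B = {}" "\<And>u v. u \<in> A \<Longrightarrow> v \<in> B \<Longrightarrow> \<not> E u v \<and> \<not> E v u"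
      and g: "inj_on g C'" "g ` C' \<subseteq> C"
    for A B C C' :: "'a set" and f f' g
  proof -
    let ?h = "\<lambda>x. if x \<in> A then f x else g (f' x)"
    have "?h ` (A \<union> B) \<subseteq> C"
      using A(3) B(1) g(2) by (auto simp: image_subset_iff)
    moreover have "\<forall>c\<in>C. ?h c = c"
      using A(1,4) by auto
    moreover have "\<not> E x y" if xy: "x \<in> A \<union> B" "y \<in> A \<union> B" "?h x = ?h y" for x y
    proof -
      consider "x \<in> A" "y \<in> A" | "x \<in> A" "y \<in> B" | "x \<in> B" "y \<in> A"
        | "x \<in> B" "y \<in> B" "x \<notin> A" "y \<notin> A"
        using xy AB(1) by blast
      then show ?thesis
      proof cases
        case 4
        then have "g (f' x) = g (f' y)" "f' x \<in> C'" "f' y \<in> C'"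
          using xy B(1) by (auto simp: image_subset_iff)
        then show ?thesis
          using 4 B(2) g(1) by (auto dest: inj_onD)
      qed (use xy A(5) AB in auto)
    qed
    ultimately show ?thesis
      using A(1,2) unfolding clique_colourable_def clique_colouring_def
      by (intro exI[of _ C] exI[of _ ?h]) blast
  qed
  obtain C f where Cf: "C \<subseteq> U" "\<forall>x\<in>C. \<forall>y\<in>C. x \<noteq> y \<longrightarrow> E x y" "f ` U \<subseteq> C" "\<forall>c\<in>C. f c = c"
      "\<forall>x\<in>U. \<forall>y\<in>U. f x = f y \<longrightarrow> \<not> E x y"
    using U unfolding clique_colourable_def clique_colouring_def by blast
  obtain C' f' where Cf': "C' \<subseteq> V" "\<forall>x\<in>C'. \<forall>y\<in>C'. x \<noteq> y \<longrightarrow> E x y" "f' ` V \<subseteq> C'" "\<forall>c\<in>C'. f' c = c"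
      "\<forall>x\<in>V. \<forall>y\<in>V. f' x = f' y \<longrightarrow> \<not> E x y"
    using V unfolding clique_colourable_def clique_colouring_def by blast
  \<comment> \<open>Any two cardinals are comparable, so one of the cliques embeds into the other
    even if both are infinite.\<close>
  have "( |C| \<le>o |C'| ) \<or> ( |C'| \<le>o |C| )"
    by (intro ordLeq_total card_of_Well_order)
  then consider g where "inj_on g C" "g ` C \<subseteq> C'" | g where "inj_on g C'" "g ` C' \<subseteq> C"
    by (auto simp flip: card_of_ordLeq)
  then show ?thesis
  proof cases
    case 1
    have "clique_colourable E (V \<union> U)"
      by (rule *[OF Cf' Cf(3,5) _ _ 1]) (use UV sym in blast)+
    then show ?thesis
      by (simp add: Un_commute)
  next
    case 2
    show ?thesis
      by (rule *[OF Cf Cf'(3,5) _ _ 2]) (use UV sym in blast)+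
  qed
qed

section \<open>Decomposition of graphs without induced paths on four vertices\<close>

locale P4_free_graph =
  fixes P :: "'a set" and E :: "'a \<Rightarrow> 'a \<Rightarrow> bool"
  assumes sym: "E x y \<Longrightarrow> E y x"
    and irrefl: "\<not> E x x"
    and P4_free: "{a, b, c, d} \<subseteq> P \<Longrightarrow> E a b \<Longrightarrow> E b c \<Longrightarrow> E c d \<Longrightarrow> E a c \<or> E a d \<or> E b d"
    and finite_independent: "I \<subseteq> P \<Longrightarrow> (\<And>x y. x \<in> I \<Longrightarrow> y \<in> I \<Longrightarrow> \<not> E x y) \<Longrightarrow> finite I"
begin

text \<open>
  Fix \<open>x\<close>. The neighbourhoods of its non-neighbours \<open>m\<close> within the neighbourhood of \<open>x\<close>
  form a chain, which is finite because adjacent non-neighbours have equal neighbourhoods there.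
  The smallest one is nonempty unless \<open>X\<close> is a disjoint union, and the set \<open>T\<close> of neighbours of
  \<open>x\<close> adjacent to every \<open>m\<close> contains it and forms a join with the rest of \<open>X\<close>.
\<close>

lemma disjoint_union_or_join:
  assumes X: "X \<subseteq> P" "x \<in> X" "y \<in> X" "x \<noteq> y"
  shows "splits (\<lambda>u v. \<not> E u v) X \<or> splits E X"
proof (rule ccontr)
  assume "\<not> ?thesis"
  then have conn: "\<And>U. U \<subseteq> X \<Longrightarrow> U \<noteq> {} \<Longrightarrow> U \<noteq> X \<Longrightarrow> \<exists>u\<in>U. \<exists>v\<in>X - U. E u v"
    and coconn: "\<And>U. U \<subseteq> X \<Longrightarrow> U \<noteq> {} \<Longrightarrow> U \<noteq> X \<Longrightarrow> \<exists>u\<in>U. \<exists>v\<in>X - U. \<not> E u v"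
    unfolding splits_def by meson+
  have P4: "E a c \<or> E a d \<or> E b d"
    if "a \<in> X" "b \<in> X" "c \<in> X" "d \<in> X" "E a b" "E b c" "E c d" for a b c d
    using P4_free[of a b c d] that X(1) by blast
  define M where "M = {m \<in> X. m \<noteq> x \<and> \<not> E x m}"
  define N where "N m = {n \<in> X. E x n \<and> E m n}" for m
  have N_adj: "N m = N m'" if "m \<in> M" "m' \<in> M" "E m m'" for m m'
  proof -
    \<comment> \<open>For \<open>n\<close> in \<open>N m\<close>, the only possible chord of the
      path \<open>x\<close>, \<open>n\<close>, \<open>m\<close>, \<open>m'\<close> joins
      \<open>n\<close> to \<open>m'\<close>.\<close>
    have "N m \<subseteq> N m'" if "m \<in> M" "m' \<in> M" "E m m'" for m m'
      using that P4[of x _ m m'] X(2) sym unfolding M_def N_def by blast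
    then show ?thesis
      using that sym by blast
  qed
  have N_nested: "N m \<subseteq> N m' \<or> N m' \<subseteq> N m" if m: "m \<in> M" "m' \<in> M" for m m'
  proof (rule ccontr)
    assume "\<not> ?thesis"
    then obtain n n' where n: "n \<in> N m" "n \<notin> N m'" "n' \<in> N m'" "n' \<notin> N m"
      by blast
    then have "\<not> E m m'"
      using N_adj m by blast
    \<comment> \<open>The path \<open>m\<close>, \<open>n\<close>, \<open>x\<close>,
      \<open>n'\<close> forces this chord; then \<open>m\<close>, \<open>n\<close>,
      \<open>n'\<close>, \<open>m'\<close> is an induced path.\<close>
    moreover have "E n n'"
      using P4[of m n x n'] n m X(2) sym unfolding M_def N_def by blast
    ultimately show False
      using P4[of m n n' m'] n m sym unfolding M_def N_def by blast
  qed
  have N_nonempty: "N m \<noteq> {}" if m: "m \<in> M" for m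
  proof
    assume "N m = {}"
    \<comment> \<open>An edge leaves the set of non-neighbours \<open>m\<close> with
      \<open>N m\<close> empty. Its outer end \<open>v\<close> is neither \<open>x\<close> nor a
      neighbour of \<open>x\<close>, so it lies in \<open>M\<close> and \<open>N v\<close> equals
      \<open>N u\<close>.\<close>
    then obtain u v where u: "u \<in> M" "N u = {}" and v: "v \<in> X" "\<not> (v \<in> M \<and> N v = {})" "E u v"
      using conn[of "{m \<in> M. N m = {}}"] m X(2) unfolding M_def by blast
    then have "v \<in> M"
      using sym unfolding M_def N_def by blast
    then show False
      using N_adj u v by blast
  qed
  define T where "T = {n \<in> X. E x n \<and> (\<forall>m\<in>M. E m n)}"
  have "T \<noteq> {}"
  proof (cases "M = {}")
    case True
    then show ?thesis
      using X unfolding T_def M_def by blast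
  next
    case False
    \<comment> \<open>\<open>I\<close> picks one vertex for each value of \<open>N\<close>; adjacent
      vertices of \<open>M\<close> share their value, so \<open>I\<close> is independent.\<close>
    obtain I where I: "I \<subseteq> M" "inj_on N I" "N ` I = N ` M"
      using subset_image_inj[of "N ` M" N M] by auto
    have "finite I"
    proof (rule finite_independent)
      show "I \<subseteq> P"
        using I(1) X(1) unfolding M_def by blast
      show "\<not> E a b" if "a \<in> I" "b \<in> I" for a b
        using that I N_adj[of a b] irrefl inj_onD[OF I(2), of a b] by blast
    qed
    then have "finite (N ` M)"
      using I(3) by (metis finite_imageI)
    then have "\<exists>B\<in>N ` M. \<forall>B'\<in>N ` M. B' \<subseteq> B \<longrightarrow> B = B'"
      by (rule finite_has_minimal) (use False in simp)
    then obtain m where m: "m \<in> M" "\<forall>m'\<in>M. N m' \<subseteq> N m \<longrightarrow> N m = N m'"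
      by auto
    have "N m \<subseteq> N m'" if "m' \<in> M" for m'
      using N_nested[OF m(1) that] m(2) that by blast
    then have "N m \<subseteq> T"
      unfolding T_def N_def by blast
    then show ?thesis
      using N_nonempty m(1) by blast
  qed
  moreover have "T \<subseteq> X" "x \<notin> T"
    using irrefl unfolding T_def by blast+
  ultimately obtain t v where t: "t \<in> T" and v: "v \<in> X" "v \<notin> T" "\<not> E t v"
    using coconn[of T] X(2) by blast
  then have "v \<noteq> x" "v \<notin> M"
    using sym unfolding T_def by blast+
  then have "E x v"
    using v(1) unfolding M_def by blast
  then obtain m where m: "m \<in> M" "\<not> E m v"
    using v unfolding T_def by blast
  \<comment> \<open>The path \<open>v\<close>, \<open>x\<close>, \<open>t\<close>, \<open>m\<close>
    is induced.\<close>
  show False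
    using P4[of v x t m] \<open>E x v\<close> t v m X(2) sym unfolding T_def M_def by blast
qed

section \<open>Recursion over vertex sets\<close>

text \<open>Only one lost vertex has to be nonadjacent to what remains; hence a part of a split
  component of \<open>X\<close> lies below \<open>X\<close> itself.\<close>

definition smaller :: "('a set \<times> 'a set) set" where
  "smaller = {(Y, X). Y \<subseteq> X \<and> X \<subseteq> P \<and> (\<exists>x\<in>X - Y. \<forall>y\<in>Y. \<not> E x y)}"

text \<open>The vertices lost along an infinite descent are distinct, and each is nonadjacent to all
  later ones, which lie in the later sets.\<close>

lemma wf_smaller: "wf smaller"
  unfolding wf_iff_no_infinite_down_chain
proof
  assume "\<exists>X. \<forall>i. (X (Suc i), X i) \<in> smaller"
  then obtain X where X: "\<And>i. (X (Suc i), X i) \<in> smaller"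
    by blast
  then have "\<exists>x. \<forall>i. x i \<in> X i \<and> x i \<notin> X (Suc i) \<and> (\<forall>y\<in>X (Suc i). \<not> E (x i) y)"
    unfolding smaller_def by (intro choice) blast
  then obtain x where x: "\<And>i. x i \<in> X i" "\<And>i. x i \<notin> X (Suc i)"
      "\<And>i y. y \<in> X (Suc i) \<Longrightarrow> \<not> E (x i) y"
    by blast
  have mono: "X j \<subseteq> X i" if "i \<le> j" for i j
  proof -
    have "X (Suc n) \<subseteq> X n" for n
      using X[of n] unfolding smaller_def by blast
    then show ?thesis
      using that by (rule lift_Suc_antimono_le)
  qed
  have later: "x j \<in> X (Suc i)" if "i < j" for i j
    using x(1) mono[of "Suc i" j] that by auto
  have "inj x"
    by (rule linorder_injI) (metis later x(2))
  moreover have "finite (range x)"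
  proof (rule finite_independent)
    show "range x \<subseteq> P"
      using x(1) X unfolding smaller_def by blast
    show "\<not> E a b" if "a \<in> range x" "b \<in> range x" for a b
    proof -
      have "\<not> E (x i) (x j)" for i j
        using later[of i j] later[of j i] x(3) sym irrefl by (metis linorder_neqE_nat)
      then show ?thesis
        using that by blast
    qed
  qed
  ultimately show False
    using finite_imageD infinite_UNIV_nat by blast
qed

lemma clique_colourable_subset: "X \<subseteq> P \<Longrightarrow> clique_colourable E X"
proof (induction X rule: wf_induct_rule[OF wf_smaller])
  case (1 X)
  define S where "S = {(u, v). u \<in> X \<and> v \<in> X \<and> \<not> E u v}"
  \<comment> \<open>\<open>K x\<close> is the component of \<open>x\<close> in the complement of the
    graph on \<open>X\<close>.\<close>
  define K where "K x = S\<^sup>* `` {x}" for x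
  have symS: "sym (S\<^sup>*)"
    using sym by (intro sym_rtrancl) (auto simp: S_def sym_def)
  have self: "x \<in> K x" for x
    by (simp add: K_def)
  have K_sub: "K x \<subseteq> X" if "x \<in> X" for x
  proof
    fix y assume "y \<in> K x"
    then have "(x, y) \<in> S\<^sup>*"
      by (simp add: K_def)
    then show "y \<in> X"
      using that by (induction) (auto simp: S_def)
  qed
  have K_eq: "K y = K x" if "y \<in> K x" for x y
    using that symS unfolding K_def by (auto dest: symD intro: rtrancl_trans)
  have K_adj: "E u v" if "u \<in> X" "v \<in> X" "K u \<noteq> K v" for u v
  proof (rule ccontr)
    assume "\<not> E u v"
    then have "v \<in> K u"
      using that unfolding K_def S_def by blast
    then show False
      using K_eq that by blast
  qed
  have no_join: "\<not> splits E (K x)" if "x \<in> X" for x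
  proof
    assume "splits E (K x)"
    then obtain U where U: "U \<subseteq> K x" "U \<noteq> {}" "U \<noteq> K x" "\<And>u v. u \<in> U \<Longrightarrow> v \<in> K x - U \<Longrightarrow> E u v"
      unfolding splits_def by blast
    then obtain u where u: "u \<in> U"
      by blast
    \<comment> \<open>A path of nonadjacent steps within \<open>K x\<close> cannot leave
      \<open>U\<close>, because \<open>U\<close> is completely joined to the rest.\<close>
    have "v \<in> U" if "(u, v) \<in> S\<^sup>*" for v
      using that
    proof induction
      case (step y z)
      then have "z \<in> K x"
        using U(1) unfolding K_def by (auto intro: rtrancl_into_rtrancl)
      then show ?case
        using step U(4) unfolding S_def by blast
    qed (rule u)
    then have "K u \<subseteq> U"
      unfolding K_def by blast
    then show False
      using K_eq[of u x] U u by blast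
  qed
  have "clique_colourable E (K x)" if x: "x \<in> X" for x
  proof (cases "K x = {x}")
    case True
    then show ?thesis
      using irrefl unfolding clique_colourable_def clique_colouring_def
      by (intro exI[of _ "{x}"] exI[of _ id]) auto
  next
    case False
    then obtain y where "y \<in> K x" "y \<noteq> x"
      using self by blast
    then have "splits (\<lambda>u v. \<not> E u v) (K x)"
      using disjoint_union_or_join[of "K x" x y] no_join K_sub self x 1(2) by blast
    then obtain U where U: "U \<subseteq> K x" "U \<noteq> {}" "U \<noteq> K x"
        "\<And>u v. u \<in> U \<Longrightarrow> v \<in> K x - U \<Longrightarrow> \<not> E u v"
      unfolding splits_def by blast
    have "(U, X) \<in> smaller" "(K x - U, X) \<in> smaller"
      using U K_sub[OF x] 1(2) sym unfolding smaller_def by blast+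
    then have "clique_colourable E U" "clique_colourable E (K x - U)"
      using 1(1)[of U] 1(1)[of "K x - U"] U(1) K_sub[OF x] 1(2) by blast+
    then have "clique_colourable E (U \<union> (K x - U))"
      by (intro clique_colourable_disjoint_union) (use sym U(4) in auto)
    then show ?thesis
      using U(1) by (simp add: Un_absorb1)
  qed
  \<comment> \<open>The choice is indexed by components rather than vertices, so that all vertices
    of a component share one clique and one colouring.\<close>
  then have "\<forall>k. \<exists>C f. k \<in> K ` X \<longrightarrow> clique_colouring E k C f"
    unfolding clique_colourable_def by blast
  then obtain C' f' where C': "\<And>k. k \<in> K ` X \<Longrightarrow> clique_colouring E k (C' k) (f' k)"
    by metis
  define C where "C x = C' (K x)" for x
  define f where "f x = f' (K x)" for x
  have C: "C x \<subseteq> K x" "\<And>u v. u \<in> C x \<Longrightarrow> v \<in> C x \<Longrightarrow> u \<noteq> v \<Longrightarrow> E u v"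
      "\<And>u. u \<in> K x \<Longrightarrow> f x u \<in> C x" "\<And>u. u \<in> C x \<Longrightarrow> f x u = u"
      "\<And>u v. u \<in> K x \<Longrightarrow> v \<in> K x \<Longrightarrow> f x u = f x v \<Longrightarrow> \<not> E u v" if "x \<in> X" for x
    using C'[of "K x"] that unfolding C_def f_def clique_colouring_def by blast+
  have C_eq: "C y = C x" "f y = f x" if "K y = K x" for x y
    using that by (simp_all add: C_def f_def)
  have K_inv: "K (f x x) = K x" if "x \<in> X" for x
    using C(1,3)[OF that] self K_eq by blast
  have C_self: "u \<in> C u" "u \<in> X" if "x \<in> X" "u \<in> C x" for x u
  proof -
    have "u \<in> K x"
      using C(1) that by blast
    then show "u \<in> C u" "u \<in> X"
      using C_eq(1)[OF K_eq] K_sub[of x] that by auto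
  qed
  \<comment> \<open>The clique is the union of the component cliques, and each vertex keeps its
    colour from its own component. Equal colours force equal components by
    \<open>K_inv\<close>.\<close>
  show ?case
    unfolding clique_colourable_def clique_colouring_def
  proof (intro exI conjI ballI impI)
    show "(\<Union>x\<in>X. C x) \<subseteq> X"
      using C(1) K_sub by blast
    show "E u v" if "u \<in> (\<Union>x\<in>X. C x)" "v \<in> (\<Union>x\<in>X. C x)" "u \<noteq> v" for u v
    proof (cases "K u = K v")
      case True
      then show ?thesis
        using that C_self[of _ u] C_self[of _ v] C_eq(1)[OF True] C(2)[of u u v] by auto
    next
      case False
      then show ?thesis
        using that C_self(2) K_adj[of u v] by auto
    qed
    show "(\<lambda>x. f x x) ` X \<subseteq> (\<Union>x\<in>X. C x)"
      using C(3) self by blast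
    show "f c c = c" if "c \<in> (\<Union>x\<in>X. C x)" for c
      using that C_self[of _ c] C(4)[of c c] by auto
    show "\<not> E u v" if "u \<in> X" "v \<in> X" "f u u = f v v" for u v
    proof -
      have "K u = K v"
        using K_inv that by metis
      then show ?thesis
        using C(5)[of u u v] that C_eq(2)[of u v] self[of u] self[of v] by auto
    qed
  qed
qed

end

section \<open>Back to posets\<close>

text \<open>By transitivity, consecutive comparabilities on an induced path must alternate in
  direction, so the path is an N read forwards or backwards.\<close>

lemma comparability_graph_P4_free:
  assumes po: "partial_order_on P r" and "N_free P r"
    and fin: "\<And>A. antichain_on P r A \<Longrightarrow> finite A"
  shows "P4_free_graph P (\<lambda>x y. x \<noteq> y \<and> \<not> incomparable r x y)"
proof
  have trans: "\<And>x y z. (x, y) \<in> r \<Longrightarrow> (y, z) \<in> r \<Longrightarrow> (x, z) \<in> r"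
    using po by (auto simp: partial_order_on_def preorder_on_def dest: transD)
  show "(a \<noteq> c \<and> \<not> incomparable r a c) \<or> (a \<noteq> d \<and> \<not> incomparable r a d) \<or>
      (b \<noteq> d \<and> \<not> incomparable r b d)"
    if abcd: "{a, b, c, d} \<subseteq> P" and ab: "a \<noteq> b \<and> \<not> incomparable r a b"
      and bc: "b \<noteq> c \<and> \<not> incomparable r b c" and cd: "c \<noteq> d \<and> \<not> incomparable r c d" for a b c d
  proof (rule ccontr)
    assume neg: "\<not> ?thesis"
    \<comment> \<open>Each coincidence would turn one of the given edges into a chord: with
      \<open>a = c\<close>, for example, the edge \<open>c d\<close> is \<open>a d\<close>.\<close>
    then have "a \<noteq> c" "b \<noteq> d" "a \<noteq> d"
      using ab cd bc unfolding incomparable_def by metis+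
    then have inc: "distinct [a, b, c, d]" "incomparable r a c" "incomparable r a d" "incomparable r b d"
      using neg ab bc cd by auto
    have "is_N P r a b c d \<or> is_N P r d c b a"
      using ab bc cd inc abcd trans unfolding is_N_def incomparable_def by auto
    then show False
      using \<open>N_free P r\<close> unfolding N_free_def by blast
  qed
  show "finite I"
    if "I \<subseteq> P" "\<And>x y. x \<in> I \<Longrightarrow> y \<in> I \<Longrightarrow> \<not> (x \<noteq> y \<and> \<not> incomparable r x y)" for I
    using that fin[of I] unfolding antichain_on_def by blast
qed (auto simp: incomparable_def)

theorem theorem8:
  fixes P :: "'a set" and r :: "'a rel"
  assumes "partial_order_on P r"
    and "N_free P r"
    and "\<And>A. antichain_on P r A \<Longrightarrow> finite A"
  shows "\<exists>C \<A>. C \<subseteq> P \<and> C \<in> Chains r \<and>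
           partition_on P \<A> \<and> (\<forall>A\<in>\<A>. antichain_on P r A) \<and>
           (\<forall>A\<in>\<A>. A \<inter> C \<noteq> {})"
proof -
  interpret P4_free_graph P "\<lambda>x y. x \<noteq> y \<and> \<not> incomparable r x y"
    by (rule comparability_graph_P4_free[OF assms])
  obtain C f where Cf: "C \<subseteq> P" "\<forall>x\<in>C. \<forall>y\<in>C. x \<noteq> y \<longrightarrow> x \<noteq> y \<and> \<not> incomparable r x y"
      "f ` P \<subseteq> C" "\<forall>c\<in>C. f c = c"
      "\<forall>x\<in>P. \<forall>y\<in>P. f x = f y \<longrightarrow> \<not> (x \<noteq> y \<and> \<not> incomparable r x y)"
    using clique_colourable_subset[OF order_refl] unfolding clique_colourable_def clique_colouring_def
    by (elim exE conjE)
  define \<A> where "\<A> = (\<lambda>c. {x \<in> P. f x = c}) ` C"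
  have refl: "(x, x) \<in> r" if "x \<in> P" for x
    using assms(1) that by (auto simp: partial_order_on_def preorder_on_def dest: refl_onD)
  have "C \<in> Chains r"
    unfolding Chains_def
  proof (intro CollectI ballI)
    show "(x, y) \<in> r \<or> (y, x) \<in> r" if "x \<in> C" "y \<in> C" for x y
      using that Cf(1,2) refl[of x] unfolding incomparable_def by (cases "x = y") auto
  qed
  moreover have "partition_on P \<A>"
  proof (rule partition_onI)
    show "\<Union>\<A> = P"
      using Cf(3) unfolding \<A>_def by blast
    show "{} \<notin> \<A>"
      using Cf(1,4) unfolding \<A>_def by auto
    show "disjnt p q" if "p \<in> \<A>" "q \<in> \<A>" "p \<noteq> q" for p q
      using that unfolding \<A>_def disjnt_def by auto
  qed
  moreover have "\<forall>A\<in>\<A>. antichain_on P r A"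
    using Cf(5) by (simp add: \<A>_def antichain_on_def) metis
  moreover have "\<forall>A\<in>\<A>. A \<inter> C \<noteq> {}"
    using Cf(1,4) unfolding \<A>_def by fast
  ultimately show ?thesis
    using Cf(1) by blast
qed

end
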